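(* Let $n>1$ be an integer. The saturation number of the zero-divisor graph $\Gamma(\mathbb{Z}_{2^n}[i])$ is $|V_{d_n}|-1$.
   Context: $\mathbb{Z}_{2^n}[i]=\{a+ib: a,b\in\mathbb{Z}_{2^n}\}\cong \mathbb{Z}[i]/\langle 2^n\rangle$ is the ring of Gaussian integers modulo $2^n$. For a commutative ring $R$, the zero-divisor graph $\Gamma(R)$ is the simple graph whose vertex set is the set $\mathcal{Z}(R)$ of nonzero zero-divisors of $R$, two distinct vertices $x,y$ being adjacent if and only if $xy=0$. For $1\le j\le 2n-1$ put $d_j=(1+i)^{2n-j}\in\mathbb{Z}_{2^n}[i]$ (these are the proper divisors of $2^n$ up to associates), and let $V_{d_j}=\{u d_j: u \text{ a unit of } \mathbb{Z}_{2^n}[i]\}$ be the associate class of $d_j$. The saturation number of a graph is the smallest cardinality of a maximal (with respect to inclusion) matching of the graph. *)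

theory Defs
  imports "HOL-Number_Theory.Residues"
begin

text \<open>\<open>gauss_ring R\<close> is \<open>R[i]\<close>; the pair \<open>(a, b)\<close> stands for \<open>a + i b\<close>.\<close>

definition gauss_ring :: "('a, 'm) ring_scheme \<Rightarrow> ('a \<times> 'a) ring" where
  "gauss_ring R =
    \<lparr>carrier = carrier R \<times> carrier R,
     monoid.mult = \<lambda>(a, b) (c, d).
       ((a \<otimes>\<^bsub>R\<^esub> c) \<ominus>\<^bsub>R\<^esub> (b \<otimes>\<^bsub>R\<^esub> d), (a \<otimes>\<^bsub>R\<^esub> d) \<oplus>\<^bsub>R\<^esub> (b \<otimes>\<^bsub>R\<^esub> c)),
     one = (\<one>\<^bsub>R\<^esub>, \<zero>\<^bsub>R\<^esub>),
     zero = (\<zero>\<^bsub>R\<^esub>, \<zero>\<^bsub>R\<^esub>),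
     add = \<lambda>(a, b) (c, d). (a \<oplus>\<^bsub>R\<^esub> c, b \<oplus>\<^bsub>R\<^esub> d)\<rparr>"

definition gauss_i :: "('a, 'm) ring_scheme \<Rightarrow> 'a \<times> 'a" where
  "gauss_i R = (\<zero>\<^bsub>R\<^esub>, \<one>\<^bsub>R\<^esub>)"

lemma gauss_ring_simps [simp]:
  "carrier (gauss_ring R) = carrier R \<times> carrier R"
  "(a, b) \<otimes>\<^bsub>gauss_ring R\<^esub> (c, d) =
    ((a \<otimes>\<^bsub>R\<^esub> c) \<ominus>\<^bsub>R\<^esub> (b \<otimes>\<^bsub>R\<^esub> d), (a \<otimes>\<^bsub>R\<^esub> d) \<oplus>\<^bsub>R\<^esub> (b \<otimes>\<^bsub>R\<^esub> c))"
  "\<one>\<^bsub>gauss_ring R\<^esub> = (\<one>\<^bsub>R\<^esub>, \<zero>\<^bsub>R\<^esub>)"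
  "\<zero>\<^bsub>gauss_ring R\<^esub> = (\<zero>\<^bsub>R\<^esub>, \<zero>\<^bsub>R\<^esub>)"
  "(a, b) \<oplus>\<^bsub>gauss_ring R\<^esub> (c, d) = (a \<oplus>\<^bsub>R\<^esub> c, b \<oplus>\<^bsub>R\<^esub> d)"
  by (simp_all add: gauss_ring_def)

lemma gauss_ring_cring:
  fixes R (structure)
  assumes "cring R"
  shows "cring (gauss_ring R)"
proof -
  interpret cring R by fact
  have ab: "abelian_group (gauss_ring R)"
  proof (rule abelian_groupI)
    fix x assume "x \<in> carrier (gauss_ring R)"
    then obtain a b where x: "x = (a, b)" "a \<in> carrier R" "b \<in> carrier R" by auto
    then have "(\<ominus> a, \<ominus> b) \<in> carrier (gauss_ring R)"
      "(\<ominus> a, \<ominus> b) \<oplus>\<^bsub>gauss_ring R\<^esub> x = \<zero>\<^bsub>gauss_ring R\<^esub>"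
      by (simp_all add: l_neg)
    then show "\<exists>y\<in>carrier (gauss_ring R). y \<oplus>\<^bsub>gauss_ring R\<^esub> x = \<zero>\<^bsub>gauss_ring R\<^esub>" by blast
  qed (clarsimp simp: a_ac)+
  have assoc: "(a \<otimes> c \<ominus> b \<otimes> d) \<otimes> e \<ominus> (a \<otimes> d \<oplus> b \<otimes> c) \<otimes> f =
        a \<otimes> (c \<otimes> e \<ominus> d \<otimes> f) \<ominus> b \<otimes> (c \<otimes> f \<oplus> d \<otimes> e)"
      "(a \<otimes> c \<ominus> b \<otimes> d) \<otimes> f \<oplus> (a \<otimes> d \<oplus> b \<otimes> c) \<otimes> e =
        a \<otimes> (c \<otimes> f \<oplus> d \<otimes> e) \<oplus> b \<otimes> (c \<otimes> e \<ominus> d \<otimes> f)"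
    if "a \<in> carrier R" "b \<in> carrier R" "c \<in> carrier R" "d \<in> carrier R"
      "e \<in> carrier R" "f \<in> carrier R" for a b c d e f
    using that by algebra+
  have distr: "(a \<oplus> c) \<otimes> e \<ominus> (b \<oplus> d) \<otimes> f = (a \<otimes> e \<ominus> b \<otimes> f) \<oplus> (c \<otimes> e \<ominus> d \<otimes> f)"
      "(a \<oplus> c) \<otimes> f \<oplus> (b \<oplus> d) \<otimes> e = (a \<otimes> f \<oplus> b \<otimes> e) \<oplus> (c \<otimes> f \<oplus> d \<otimes> e)"
    if "a \<in> carrier R" "b \<in> carrier R" "c \<in> carrier R" "d \<in> carrier R"
      "e \<in> carrier R" "f \<in> carrier R" for a b c d e f
    using that by algebra+
  have comm: "a \<otimes> c \<ominus> b \<otimes> d = c \<otimes> a \<ominus> d \<otimes> b" "a \<otimes> d \<oplus> b \<otimes> c = c \<otimes> b \<oplus> d \<otimes> a"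
    if "a \<in> carrier R" "b \<in> carrier R" "c \<in> carrier R" "d \<in> carrier R" for a b c d
    using that by algebra+
  have "comm_monoid (gauss_ring R)"
  proof (rule comm_monoidI)
    fix x y assume "x \<in> carrier (gauss_ring R)" "y \<in> carrier (gauss_ring R)"
    then obtain a b c d where "x = (a, b)" "y = (c, d)"
      "a \<in> carrier R" "b \<in> carrier R" "c \<in> carrier R" "d \<in> carrier R" by auto
    then show "x \<otimes>\<^bsub>gauss_ring R\<^esub> y \<in> carrier (gauss_ring R)"
      and "x \<otimes>\<^bsub>gauss_ring R\<^esub> y = y \<otimes>\<^bsub>gauss_ring R\<^esub> x"
      using comm by simp_all
  next
    fix x y z assume "x \<in> carrier (gauss_ring R)" "y \<in> carrier (gauss_ring R)"
      "z \<in> carrier (gauss_ring R)"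
    then obtain a b c d e f where "x = (a, b)" "y = (c, d)" "z = (e, f)"
      "a \<in> carrier R" "b \<in> carrier R" "c \<in> carrier R" "d \<in> carrier R"
      "e \<in> carrier R" "f \<in> carrier R" by auto
    then show "(x \<otimes>\<^bsub>gauss_ring R\<^esub> y) \<otimes>\<^bsub>gauss_ring R\<^esub> z =
        x \<otimes>\<^bsub>gauss_ring R\<^esub> (y \<otimes>\<^bsub>gauss_ring R\<^esub> z)"
      using assoc by simp
  qed (auto simp: minus_eq)
  moreover have "(x \<oplus>\<^bsub>gauss_ring R\<^esub> y) \<otimes>\<^bsub>gauss_ring R\<^esub> z =
      (x \<otimes>\<^bsub>gauss_ring R\<^esub> z) \<oplus>\<^bsub>gauss_ring R\<^esub> (y \<otimes>\<^bsub>gauss_ring R\<^esub> z)"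
    if "x \<in> carrier (gauss_ring R)" "y \<in> carrier (gauss_ring R)" "z \<in> carrier (gauss_ring R)"
    for x y z
  proof -
    from that obtain a b c d e f where "x = (a, b)" "y = (c, d)" "z = (e, f)"
      "a \<in> carrier R" "b \<in> carrier R" "c \<in> carrier R" "d \<in> carrier R"
      "e \<in> carrier R" "f \<in> carrier R" by auto
    then show ?thesis using distr by simp
  qed
  ultimately show ?thesis using ab by (intro cringI)
qed

lemma gauss_i_square:
  assumes "cring R"
  shows "gauss_i R \<otimes>\<^bsub>gauss_ring R\<^esub> gauss_i R = \<ominus>\<^bsub>gauss_ring R\<^esub> \<one>\<^bsub>gauss_ring R\<^esub>"
proof -
  interpret cring R by fact
  interpret G: cring "gauss_ring R" by (rule gauss_ring_cring) fact
  show ?thesis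
    by (rule G.minus_equality [symmetric])
      (auto simp: gauss_i_def minus_eq l_neg)
qed

text \<open>The ring \<open>\<int>\<^sub>m[i]\<close>; as for \<open>residue_ring\<close>, this is meant for \<open>m > 1\<close>.\<close>

definition gauss_mod :: "int \<Rightarrow> (int \<times> int) ring" where
  "gauss_mod m = gauss_ring (residue_ring m)"

lemma gauss_mod_cring:
  assumes "m > 1"
  shows "cring (gauss_mod m)"
proof -
  interpret residues m "residue_ring m" by unfold_locales fact
  show ?thesis unfolding gauss_mod_def by (intro gauss_ring_cring cring)
qed

lemma finite_gauss_mod: "finite (carrier (gauss_mod m))"
  by (simp add: gauss_mod_def residue_ring_def)

definition associate_class :: "('a, 'm) ring_scheme \<Rightarrow> 'a \<Rightarrow> 'a set" where
  "associate_class R d = {u \<otimes>\<^bsub>R\<^esub> d | u. u \<in> Units R}"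

text \<open>\<open>gauss_d n j\<close> is meant for \<open>1 \<le> j \<le> 2n - 1\<close>.\<close>

definition gauss_d :: "nat \<Rightarrow> nat \<Rightarrow> int \<times> int" where
  "gauss_d n j =
    (\<one>\<^bsub>gauss_mod (2 ^ n)\<^esub> \<oplus>\<^bsub>gauss_mod (2 ^ n)\<^esub> gauss_i (residue_ring (2 ^ n)))
      [^]\<^bsub>gauss_mod (2 ^ n)\<^esub> (2 * n - j)"

text \<open>An edge is the two-element set of its endpoints.\<close>

record 'a simple_graph =
  vertices :: "'a set"
  edges :: "'a set set"

definition matching :: "'a simple_graph \<Rightarrow> 'a set set \<Rightarrow> bool" where
  "matching G M \<longleftrightarrow> M \<subseteq> edges G \<and> (\<forall>e\<in>M. \<forall>f\<in>M. e \<noteq> f \<longrightarrow> e \<inter> f = {})"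

definition maximal_matching :: "'a simple_graph \<Rightarrow> 'a set set \<Rightarrow> bool" where
  "maximal_matching G M \<longleftrightarrow> matching G M \<and> (\<forall>N. matching G N \<and> M \<subseteq> N \<longrightarrow> N = M)"

text \<open>Meaningful for finite graphs, where a maximal matching exists and is finite.\<close>

definition saturation_number :: "'a simple_graph \<Rightarrow> nat" where
  "saturation_number G = (LEAST k. \<exists>M. maximal_matching G M \<and> card M = k)"

lemma saturation_number_attained:
  assumes "finite (edges G)"
  shows "\<exists>M. maximal_matching G M \<and> finite M \<and> card M = saturation_number G"
proof -
  have "finite {M. matching G M}"
    by (rule finite_subset [of _ "Pow (edges G)"]) (use assms in \<open>auto simp: matching_def\<close>)
  moreover have "{} \<in> {M. matching G M}" by (simp add: matching_def)
  ultimately obtain M where M: "M \<in> {M. matching G M}"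
    and max: "\<forall>N\<in>{M. matching G M}. M \<subseteq> N \<longrightarrow> M = N"
    by (metis finite_has_maximal emptyE)
  from M max have "maximal_matching G M"
    by (auto simp: maximal_matching_def)
  then have "\<exists>k M. maximal_matching G M \<and> card M = k"
    by blast
  then have "\<exists>M. maximal_matching G M \<and> card M = saturation_number G"
    unfolding saturation_number_def by (rule LeastI_ex)
  then obtain M' where M': "maximal_matching G M'" "card M' = saturation_number G"
    by blast
  then have "M' \<subseteq> edges G"
    by (simp add: maximal_matching_def matching_def)
  with assms have "finite M'" by (rule rev_finite_subset)
  with M' show ?thesis by (intro exI [of _ M']) simp
qed

definition nonzero_zero_divisors :: "('a, 'm) ring_scheme \<Rightarrow> 'a set" where
  "nonzero_zero_divisors R =
    {x \<in> carrier R - {\<zero>\<^bsub>R\<^esub>}. \<exists>y \<in> carrier R - {\<zero>\<^bsub>R\<^esub>}. x \<otimes>\<^bsub>R\<^esub> y = \<zero>\<^bsub>R\<^esub>}"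

definition zero_divisor_graph :: "('a, 'm) ring_scheme \<Rightarrow> 'a simple_graph" where
  "zero_divisor_graph R =
    \<lparr>vertices = nonzero_zero_divisors R,
     edges = {{x, y} | x y. x \<in> nonzero_zero_divisors R \<and> y \<in> nonzero_zero_divisors R \<and>
                x \<noteq> y \<and> x \<otimes>\<^bsub>R\<^esub> y = \<zero>\<^bsub>R\<^esub>}\<rparr>"

lemma finite_edges_zero_divisor_graph:
  assumes "finite (carrier R)"
  shows "finite (edges (zero_divisor_graph R))"
  by (rule finite_subset [of _ "Pow (carrier R)"])
    (use assms in \<open>auto simp: zero_divisor_graph_def nonzero_zero_divisors_def\<close>)

end

theory Submission
  imports Defs
begin

text \<open>
  Write \<open>\<pi> = 1 + i\<close>. The nonzero elements of the ideal \<open>(\<pi>\<^sup>n)\<close> form a clique of the graph, and there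
  are \<open>2 |V| - 1\<close> of them, where \<open>V\<close> is the associate class of \<open>\<pi>\<^sup>n\<close>. A maximal matching
  misses at most one vertex of a clique, so it has at least \<open>|V| - 1\<close> edges. Conversely, a perfect
  matching of the clique without \<open>\<pi>\<^sup>n\<close> is maximal: two elements outside \<open>(\<pi>\<^sup>n)\<close>, or one of
  them and \<open>\<pi>\<^sup>n\<close>, have a nonzero product. The \<open>\<pi>\<close>-adic valuation of a
  Gaussian integer is the 2-adic valuation of its norm, and this norm is well defined modulo
  \<open>2\<^sup>n\<^sup>+\<^sup>1\<close> on residues modulo \<open>2\<^sup>n\<close>.
\<close>

section \<open>Saturation number and cliques\<close>

text \<open>Vertices are paired off two at a time; a new pair is disjoint from the edges chosen
  before, since these cover exactly the remaining vertices.\<close>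

lemma even_clique_perfect_matching:
  assumes "finite X" and "even (card X)"
    and clique: "\<And>x y. x \<in> X \<Longrightarrow> y \<in> X \<Longrightarrow> x \<noteq> y \<Longrightarrow> {x, y} \<in> edges G"
  shows "\<exists>M. matching G M \<and> \<Union>M = X \<and> 2 * card M = card X \<and> finite M"
proof -
  obtain k where "card X = 2 * k" using assms(2) by blast
  then show ?thesis using assms(1) clique
  proof (induction k arbitrary: X)
    case 0
    then show ?case by (intro exI [of _ "{}"]) (auto simp: matching_def)
  next
    case (Suc k)
    then obtain x Y where x: "X = insert x Y" "x \<notin> Y" "card Y = Suc (2 * k)"
      by (metis card_eq_SucD mult_Suc_right add_2_eq_Suc)
    then obtain y Z where y: "Y = insert y Z" "y \<notin> Z" "card Z = 2 * k"
      by (metis card_eq_SucD)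
    have "finite Z" using Suc.prems x y by simp
    then obtain M where M: "matching G M" "\<Union>M = Z" "2 * card M = card Z" "finite M"
      using Suc.IH [of Z] Suc.prems x y by auto
    have "{x, y} \<in> edges G" using Suc.prems x y by auto
    moreover have "x \<notin> Z" "y \<notin> Z" "{x, y} \<notin> M" using x y M by auto
    moreover have "x \<notin> e" "y \<notin> e" if "e \<in> M" for e
      using that M(2) \<open>x \<notin> Z\<close> \<open>y \<notin> Z\<close> by blast+
    ultimately have "matching G (insert {x, y} M)"
      using M(1) unfolding matching_def by auto
    moreover have "\<Union>(insert {x, y} M) = X" using M(2) x y by auto
    moreover have "2 * card (insert {x, y} M) = card X"
      using M \<open>{x, y} \<notin> M\<close> Suc.prems y by simp
    ultimately show ?case using M(4) by blast
  qed
qed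

text \<open>Two uncovered vertices of \<open>K\<close> span an edge that could be added to
  \<open>M\<close>. Hence \<open>M\<close> covers all but at most one vertex of \<open>K\<close>,
  and each of its edges covers at most two.\<close>

lemma card_clique_le_maximal_matching:
  assumes M: "maximal_matching G M" and "finite M" and "finite K"
    and edge2: "\<And>e. e \<in> edges G \<Longrightarrow> finite e \<and> card e \<le> 2"
    and clique: "\<And>x y. x \<in> K \<Longrightarrow> y \<in> K \<Longrightarrow> x \<noteq> y \<Longrightarrow> {x, y} \<in> edges G"
  shows "card K \<le> 2 * card M + 1"
proof -
  have matching: "matching G M" and max: "\<And>N. matching G N \<Longrightarrow> M \<subseteq> N \<Longrightarrow> N = M"
    using M by (auto simp: maximal_matching_def)
  have sub: "M \<subseteq> edges G" using matching by (simp add: matching_def)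
  have "x = y" if "x \<in> K - \<Union>M" "y \<in> K - \<Union>M" for x y
  proof (rule ccontr)
    assume "x \<noteq> y"
    then have "{x, y} \<in> edges G" using clique that by blast
    then have "matching G (insert {x, y} M)"
      using matching that unfolding matching_def by auto
    then have "insert {x, y} M = M" using max by blast
    with that show False by blast
  qed
  then have "card (K - \<Union>M) \<le> 1"
    by (metis card_le_Suc0_iff_eq One_nat_def \<open>finite K\<close> finite_Diff)
  moreover have "card (\<Union>M) \<le> 2 * card M"
  proof -
    have "card (\<Union>M) \<le> sum card M"
      by (rule card_Union_le_sum_card)
    also have "\<dots> \<le> (\<Sum>e\<in>M. 2)" by (rule sum_mono) (use sub edge2 in blast)
    finally show ?thesis by simp
  qed
  moreover have "card K \<le> card (\<Union>M \<union> (K - \<Union>M))"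
    by (rule card_mono) (use sub edge2 assms in auto)
  moreover have "card (\<Union>M \<union> (K - \<Union>M)) \<le> card (\<Union>M) + card (K - \<Union>M)"
    by (rule card_Un_le)
  ultimately show ?thesis by linarith
qed

text \<open>Without \<open>w\<close> the clique is even and has a perfect matching with
  \<open>k\<close> edges, which by \<open>meet\<close> cannot be extended. The lower bound for odd
  cliques matches it exactly.\<close>

lemma saturation_number_odd_clique:
  assumes "finite (edges G)" and "finite K" and card: "card K = 2 * k + 1" and "w \<in> K"
    and edge2: "\<And>e. e \<in> edges G \<Longrightarrow> finite e \<and> card e \<le> 2"
    and clique: "\<And>x y. x \<in> K \<Longrightarrow> y \<in> K \<Longrightarrow> x \<noteq> y \<Longrightarrow> {x, y} \<in> edges G"
    and meet: "\<And>e. e \<in> edges G \<Longrightarrow> e \<inter> (K - {w}) \<noteq> {}"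
  shows "saturation_number G = k"
proof -
  have "card (K - {w}) = 2 * k" using assms by simp
  then obtain M where M: "matching G M" "\<Union>M = K - {w}" "2 * card M = 2 * k"
    using even_clique_perfect_matching [of "K - {w}" G] clique \<open>finite K\<close> by auto
  have "N = M" if N: "matching G N" "M \<subseteq> N" for N
  proof (rule ccontr)
    assume "N \<noteq> M"
    then obtain e where e: "e \<in> N" "e \<notin> M" using N by blast
    then have "e \<inter> f = {}" if "f \<in> M" for f
      using N that unfolding matching_def by (metis subsetD)
    then have "e \<inter> (K - {w}) = {}" using M(2) by blast
    moreover have "e \<in> edges G" using e N by (auto simp: matching_def)
    ultimately show False using meet by blast
  qed
  with M have "maximal_matching G M" "card M = k" by (auto simp: maximal_matching_def)
  then have "saturation_number G \<le> k"
    unfolding saturation_number_def by (intro Least_le) blast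
  moreover obtain M' where "maximal_matching G M'" "finite M'" "card M' = saturation_number G"
    using saturation_number_attained [OF assms(1)] by blast
  then have "card K \<le> 2 * saturation_number G + 1"
    using card_clique_le_maximal_matching [of G M' K] edge2 clique \<open>finite K\<close> by metis
  ultimately show ?thesis using card by simp
qed

section \<open>Gaussian integers and their residues\<close>

text \<open>Gaussian integers are unreduced integer pairs, so that norms and their divisibility by
  powers of 2 live in the integers until \<open>red\<close> is applied.\<close>

definition gmul :: "int \<times> int \<Rightarrow> int \<times> int \<Rightarrow> int \<times> int" where
  "gmul x y = (fst x * fst y - snd x * snd y, fst x * snd y + snd x * fst y)"

definition gconj :: "int \<times> int \<Rightarrow> int \<times> int" where
  "gconj x = (fst x, - snd x)"

definition gnorm :: "int \<times> int \<Rightarrow> int" where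
  "gnorm x = fst x ^ 2 + snd x ^ 2"

definition red :: "int \<Rightarrow> int \<times> int \<Rightarrow> int \<times> int" where
  "red m x = (fst x mod m, snd x mod m)"

fun ppow :: "nat \<Rightarrow> int \<times> int" where
  "ppow 0 = (1, 0)"
| "ppow (Suc k) = gmul (ppow k) (1, 1)"

lemma gnorm_gmul: "gnorm (gmul x y) = gnorm x * gnorm y"
  by (simp add: gnorm_def gmul_def power2_eq_square algebra_simps)

lemma gnorm_gconj [simp]: "gnorm (gconj x) = gnorm x"
  by (simp add: gnorm_def gconj_def)

lemma gnorm_ppow: "gnorm (ppow k) = 2 ^ k"
  by (induction k) (simp_all add: gnorm_gmul, simp_all add: gnorm_def)

section \<open>Sums of two squares and powers of 4\<close>

lemma sum_squares_4_dvd_even: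
  fixes a b :: int
  assumes "4 dvd a\<^sup>2 + b\<^sup>2"
  shows "even a \<and> even b"
proof -
  have sq: "x\<^sup>2 mod 4 = (if even x then 0 else 1)" for x :: int
  proof (cases "even x")
    case True
    then obtain k where "x = 2 * k" by blast
    then show ?thesis by (simp add: power2_eq_square)
  next
    case False
    then obtain k where "x = 2 * k + 1" by (rule oddE)
    then have "x\<^sup>2 = 1 + 4 * (k\<^sup>2 + k)" by (simp add: power2_eq_square algebra_simps)
    then have "x\<^sup>2 mod 4 = 1" by (simp only: mod_mult_self2) simp
    then show ?thesis using False by simp
  qed
  have "(a\<^sup>2 mod 4 + b\<^sup>2 mod 4) mod 4 = 0"
    using assms by (simp add: mod_add_eq)
  then show ?thesis by (auto simp: sq split: if_splits)
qed

text \<open>Descent: a common factor 2 of \<open>a\<close> and \<open>b\<close> is a factor 4 of the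
  sum. If there is none, both sides fail for positive exponents.\<close>

lemma power_4_dvd_sum_squares_iff:
  fixes a b :: int
  shows "4 ^ n dvd a\<^sup>2 + b\<^sup>2 \<longleftrightarrow> 2 ^ n dvd a \<and> 2 ^ n dvd b"
proof (induction n arbitrary: a b)
  case (Suc n)
  show ?case
  proof (cases "even a \<and> even b")
    case True
    then obtain c d where "a = 2 * c" "b = 2 * d" by blast
    moreover from this have "a\<^sup>2 + b\<^sup>2 = 4 * (c\<^sup>2 + d\<^sup>2)" by (simp add: power_mult_distrib)
    moreover have "4 * 4 ^ n dvd 4 * (c\<^sup>2 + d\<^sup>2) \<longleftrightarrow> 4 ^ n dvd c\<^sup>2 + d\<^sup>2"
      by (subst dvd_mult_cancel_left) simp
    ultimately show ?thesis using Suc by simp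
  next
    case False
    then have "\<not> 4 dvd a\<^sup>2 + b\<^sup>2" using sum_squares_4_dvd_even by blast
    moreover have "\<not> (2 ^ Suc n dvd a \<and> 2 ^ Suc n dvd b)"
      using False by (auto dest: dvd_mult_left)
    ultimately show ?thesis by (auto dest: dvd_mult_left)
  qed
qed simp

text \<open>This turns the vanishing of a product in the ring into a condition on the product of the
  norms.\<close>

lemma red_eq_zero_iff: "red (2 ^ n) x = (0, 0) \<longleftrightarrow> 2 ^ (2 * n) dvd gnorm x"
proof -
  have "(2 ^ (2 * n) :: int) = 4 ^ n" by (simp add: power_mult)
  then show ?thesis
    by (simp add: gnorm_def power_4_dvd_sum_squares_iff red_def mod_eq_0_iff_dvd)
qed

section \<open>Norms of residues\<close>

text \<open>For \<open>a = m * q + r\<close> the cross term \<open>2 * m * q * r\<close> is a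
  multiple of \<open>2 * m\<close>, and so is \<open>m * m\<close> because \<open>m\<close> is even.
  The extra factor 2 makes divisibility by \<open>2 ^ Suc n\<close> testable on residues modulo
  \<open>2 ^ n\<close>.\<close>

lemma square_mod_cong:
  fixes a m :: int
  assumes "even m"
  shows "[(a mod m)\<^sup>2 = a\<^sup>2] (mod (2 * m))"
proof -
  obtain h where h: "m = 2 * h" using assms by blast
  define q r where "q = a div m" and "r = a mod m"
  have a: "a = m * q + r" by (simp add: q_def r_def)
  have "a\<^sup>2 - r\<^sup>2 = (2 * m) * (q * r + h * q\<^sup>2)"
    unfolding a by (simp add: power2_eq_square algebra_simps h)
  then have "2 * m dvd a\<^sup>2 - r\<^sup>2" by simp
  then show ?thesis unfolding r_def using cong_iff_dvd_diff cong_sym by blast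
qed

lemma gnorm_red_cong:
  assumes "even m"
  shows "[gnorm (red m x) = gnorm x] (mod (2 * m))"
  unfolding gnorm_def red_def using assms by (auto intro: cong_add square_mod_cong)

lemma gnorm_red_dvd_iff:
  assumes "k \<le> Suc n" and "n > 0"
  shows "2 ^ k dvd gnorm (red (2 ^ n) x) \<longleftrightarrow> 2 ^ k dvd gnorm x"
proof -
  have "[gnorm (red (2 ^ n) x) = gnorm x] (mod (2 ^ Suc n))"
    using gnorm_red_cong [of "2 ^ n" x] assms by simp
  then have "[gnorm (red (2 ^ n) x) = gnorm x] (mod (2 ^ k))"
    by (rule cong_dvd_modulus) (rule le_imp_power_dvd [OF assms(1)])
  then show ?thesis by (rule cong_dvd_iff)
qed

lemma red_gmul_red: "red m (gmul (red m x) (red m y)) = red m (gmul x y)"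
  unfolding red_def gmul_def by (auto intro!: mod_diff_cong mod_add_cong mod_mult_cong)

lemma gmul_assoc: "gmul (gmul x y) z = gmul x (gmul y z)"
  by (simp add: gmul_def algebra_simps)

lemma gmul_commute: "gmul x y = gmul y x"
  by (simp add: gmul_def algebra_simps)

lemma gmul_gconj: "gmul x (gconj x) = (gnorm x, 0)"
  by (simp add: gmul_def gconj_def gnorm_def power2_eq_square)

section \<open>The operations of \<open>gauss_mod\<close> on integer pairs\<close>

lemma carrier_gauss_mod: "carrier (gauss_mod m) = {0..m - 1} \<times> {0..m - 1}"
  by (simp add: gauss_mod_def residue_ring_def)

lemma zero_gauss_mod: "\<zero>\<^bsub>gauss_mod m\<^esub> = (0, 0)"
  by (simp add: gauss_mod_def residue_ring_def)

lemma one_gauss_mod: "\<one>\<^bsub>gauss_mod m\<^esub> = (1, 0)"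
  by (simp add: gauss_mod_def residue_ring_def)

lemma mult_gauss_mod:
  assumes "m > 1"
  shows "x \<otimes>\<^bsub>gauss_mod m\<^esub> y = red m (gmul x y)"
proof -
  interpret residues m "residue_ring m" by unfold_locales fact
  show ?thesis
    by (cases x; cases y) (simp add: gauss_mod_def red_def gmul_def a_minus_def
      res_add_eq res_neg_eq res_mult_eq mod_simps)
qed

lemma red_in_carrier: "m > 0 \<Longrightarrow> red m x \<in> carrier (gauss_mod m)"
  by (simp add: red_def carrier_gauss_mod zle_diff1_eq)

lemma red_id: "x \<in> carrier (gauss_mod m) \<Longrightarrow> red m x = x"
  by (auto simp: red_def carrier_gauss_mod)

section \<open>Powers of \<open>1 + i\<close>\<close>

lemma gauss_d_eq:
  assumes "n > 0"
  shows "gauss_d n j = red (2 ^ n) (ppow (2 * n - j))"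
proof -
  let ?m = "2 ^ n :: int"
  have m: "?m > 1" using assms by simp
  have base: "\<one>\<^bsub>gauss_mod ?m\<^esub> \<oplus>\<^bsub>gauss_mod ?m\<^esub> gauss_i (residue_ring ?m) = (1, 1)"
    using m assms by (simp add: gauss_mod_def gauss_i_def residue_ring_def)
  have "(1, 1) [^]\<^bsub>gauss_mod ?m\<^esub> k = red ?m (ppow k)" for k :: nat
  proof (induction k)
    case 0
    then show ?case using m assms by (simp add: one_gauss_mod red_def)
  next
    case (Suc k)
    have "red ?m (1, 1) = (1, 1)" using m assms by (simp add: red_def)
    then show ?case
      using Suc red_gmul_red [of ?m "ppow k" "(1, 1)"] by (simp add: mult_gauss_mod [OF m])
  qed
  then show ?thesis unfolding gauss_d_def base by blast
qed

text \<open>The parity of the norm survives reduction and is multiplicative, so units have odd norm.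
  Conversely, \<open>gconj u\<close> times an inverse of the norm modulo \<open>2 ^ n\<close>
  inverts \<open>u\<close>.\<close>

lemma Units_gauss_mod_iff:
  assumes "n > 0"
  shows "u \<in> Units (gauss_mod (2 ^ n)) \<longleftrightarrow> u \<in> carrier (gauss_mod (2 ^ n)) \<and> odd (gnorm u)"
proof -
  let ?m = "2 ^ n :: int"
  have m: "?m > 1" using assms by simp
  interpret cring "gauss_mod ?m" by (rule gauss_mod_cring [OF m])
  have one: "\<one>\<^bsub>gauss_mod ?m\<^esub> = red ?m (1, 0)" using m assms by (simp add: one_gauss_mod red_def)
  show ?thesis
  proof safe
    assume "u \<in> Units (gauss_mod ?m)" "even (gnorm u)"
    then obtain v where "red ?m (gmul u v) = red ?m (1, 0)"
      by (auto simp: Units_def mult_gauss_mod [OF m] one)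
    then have "even (gnorm (gmul u v)) = even (gnorm (1, 0))"
      by (metis gnorm_red_dvd_iff [of 1 n] power_one_right assms One_nat_def Suc_le_mono le0)
    then show False using \<open>even (gnorm u)\<close> by (simp add: gnorm_gmul) (simp add: gnorm_def)
  next
    assume u: "u \<in> carrier (gauss_mod ?m)" "odd (gnorm u)"
    then have "coprime (gnorm u) ?m" by simp
    then obtain t where t: "[gnorm u * t = 1] (mod ?m)" using cong_solve_coprime_int by blast
    let ?v = "red ?m (gmul (gconj u) (t, 0))"
    have "u \<otimes>\<^bsub>gauss_mod ?m\<^esub> ?v = red ?m (gmul u (gmul (gconj u) (t, 0)))"
      using red_gmul_red [of ?m u "gmul (gconj u) (t, 0)"] red_id [OF u(1)]
      by (simp add: mult_gauss_mod [OF m])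
    also have "gmul u (gmul (gconj u) (t, 0)) = (gnorm u * t, 0)"
      by (simp add: gmul_assoc [symmetric] gmul_gconj) (simp add: gmul_def)
    also have "red ?m (gnorm u * t, 0) = \<one>\<^bsub>gauss_mod ?m\<^esub>"
      unfolding one using t by (simp add: red_def cong_def)
    finally have inv: "u \<otimes>\<^bsub>gauss_mod ?m\<^esub> ?v = \<one>\<^bsub>gauss_mod ?m\<^esub>" .
    have v: "?v \<in> carrier (gauss_mod ?m)" using m by (intro red_in_carrier) simp
    show "u \<in> Units (gauss_mod ?m)"
      using u(1) v inv m_comm [OF v u(1)] unfolding Units_def by auto
  qed (simp add: Units_def)
qed

text \<open>If the norm of \<open>x\<close> has exactly \<open>n\<close> factors 2, then
  \<open>x\<close> is \<open>ppow n\<close> times a cofactor of odd norm, and this cofactor reduces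
  to a unit.\<close>

lemma associate_class_gauss_d:
  assumes "n > 0"
  shows "associate_class (gauss_mod (2 ^ n)) (gauss_d n n) =
    {x \<in> carrier (gauss_mod (2 ^ n)). 2 ^ n dvd gnorm x \<and> \<not> 2 ^ Suc n dvd gnorm x}"
    (is "?V = ?W")
proof -
  let ?m = "2 ^ n :: int"
  have m: "?m > 1" using assms by simp
  have d: "gauss_d n n = red ?m (ppow n)"
    using gauss_d_eq [OF assms, of n] by simp
  have prod: "u \<otimes>\<^bsub>gauss_mod ?m\<^esub> gauss_d n n = red ?m (gmul u (ppow n))"
    if "u \<in> carrier (gauss_mod ?m)" for u
    using red_gmul_red [of ?m u "ppow n"] red_id [OF that] by (simp add: mult_gauss_mod [OF m] d)
  show ?thesis
  proof safe
    fix x assume "x \<in> ?V"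
    then obtain u where u: "u \<in> carrier (gauss_mod ?m)" "odd (gnorm u)"
      and x: "x = red ?m (gmul u (ppow n))"
      by (auto simp: associate_class_def Units_gauss_mod_iff [OF assms] prod)
    show "x \<in> carrier (gauss_mod ?m)" unfolding x using m by (intro red_in_carrier) simp
    show "?m dvd gnorm x"
      unfolding x using assms by (simp add: gnorm_red_dvd_iff gnorm_gmul gnorm_ppow)
    assume "2 ^ Suc n dvd gnorm x"
    then have "2 * ?m dvd gnorm u * ?m"
      unfolding x using assms gnorm_red_dvd_iff [of "Suc n" n "gmul u (ppow n)"]
      by (simp add: gnorm_gmul gnorm_ppow)
    then show False using u(2) m by simp
  next
    fix x assume x: "x \<in> carrier (gauss_mod ?m)" "?m dvd gnorm x" "\<not> 2 ^ Suc n dvd gnorm x"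
    \<comment> \<open>Division of \<open>x\<close> by \<open>ppow n\<close>: multiply by the
      conjugate, then divide by the norm \<open>2 ^ n\<close>. The norm criterion shows that both
      coordinates of \<open>?y\<close> are multiples of \<open>2 ^ n\<close>.\<close>
    let ?y = "gmul x (gconj (ppow n))"
    have N: "gnorm ?y = gnorm x * ?m" by (simp add: gnorm_gmul gnorm_ppow)
    then have "2 ^ (2 * n) dvd gnorm ?y"
      using x(2) by (simp add: mult_2 power_add mult_dvd_mono)
    then have "red ?m ?y = (0, 0)" by (simp add: red_eq_zero_iff)
    then obtain a b where "fst ?y = ?m * a" "snd ?y = ?m * b"
      unfolding red_def by (metis Pair_inject mod_0_imp_dvd dvdE)
    then have y: "?y = gmul (a, b) (?m, 0)" by (simp add: gmul_def prod_eq_iff)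
    \<comment> \<open>The two sides are compared after scaling by \<open>?m\<close>, which can be
      cancelled in the integers.\<close>
    have "gmul (gmul (a, b) (ppow n)) (?m, 0) = gmul ?y (ppow n)"
      unfolding y by (metis gmul_assoc gmul_commute)
    also have "\<dots> = gmul x (?m, 0)"
      by (metis gmul_assoc gmul_commute gmul_gconj gnorm_ppow)
    finally have xab: "gmul (a, b) (ppow n) = x" using m by (simp add: gmul_def prod_eq_iff)
    have "gnorm x = gnorm (a, b) * ?m"
      unfolding xab [symmetric] by (simp add: gnorm_gmul gnorm_ppow)
    then have "odd (gnorm (a, b))" using x(3) by auto
    then have u: "odd (gnorm (red ?m (a, b)))"
      using gnorm_red_dvd_iff [of 1 n "(a, b)"] assms by simp
    have uc: "red ?m (a, b) \<in> carrier (gauss_mod ?m)" using m by (intro red_in_carrier) simp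
    have "red ?m (a, b) \<otimes>\<^bsub>gauss_mod ?m\<^esub> gauss_d n n = x"
      using red_gmul_red [of ?m "(a, b)" "ppow n"] red_id [OF x(1)] xab
      by (simp add: mult_gauss_mod [OF m] d)
    moreover have "red ?m (a, b) \<in> Units (gauss_mod ?m)"
      using u uc by (simp add: Units_gauss_mod_iff [OF assms])
    ultimately show "x \<in> ?V" unfolding associate_class_def by blast
  qed
qed

text \<open>Since the residue field has two elements, translation by \<open>\<pi>\<^sup>n\<close> exchanges \<open>V\<close> with its
  complement in the ideal \<open>(\<pi>\<^sup>n)\<close>.\<close>

lemma card_ideal_eq_twice:
  assumes "n > 0"
  shows "card {x \<in> carrier (gauss_mod (2 ^ n)). 2 ^ n dvd gnorm x} =
    2 * card {x \<in> carrier (gauss_mod (2 ^ n)). 2 ^ n dvd gnorm x \<and> \<not> 2 ^ Suc n dvd gnorm x}"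
    (is "card ?I = 2 * card ?V")
proof -
  let ?m = "2 ^ n :: int"
  obtain a b where p: "ppow n = (a, b)" by fastforce
  define s t where "s = (\<lambda>x. red ?m (fst x + a, snd x + b))"
    and "t = (\<lambda>x. red ?m (fst x - a, snd x - b))"
  \<comment> \<open>The sign \<open>c\<close> is 1 or -1 and covers both \<open>t\<close> and
    \<open>s\<close>. The cross term is, up to sign, twice the real part of \<open>x\<close> times
    the conjugate of \<open>ppow n\<close>, and that real part is a multiple of
    \<open>2 ^ n\<close>.\<close>
  have norm_shift: "[gnorm (fst x + c * a, snd x + c * b) = gnorm x + ?m] (mod (2 ^ Suc n))"
    if "?m dvd gnorm x" and "c\<^sup>2 = 1" for x c
  proof -
    have "gnorm (gmul x (gconj (a, b))) = gnorm x * ?m"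
      using gnorm_ppow [of n] p by (simp add: gnorm_gmul)
    then have "2 ^ (2 * n) dvd gnorm (gmul x (gconj (a, b)))"
      using that by (simp add: mult_2 power_add mult_dvd_mono)
    then have "?m dvd fst x * a + snd x * b"
      unfolding red_eq_zero_iff [symmetric] by (auto simp: red_def gmul_def gconj_def)
    then have "2 ^ Suc n dvd c * (2 * (fst x * a + snd x * b))"
      by (simp only: power_Suc dvd_mult mult_dvd_mono [OF dvd_refl])
    moreover have "gnorm (fst x + c * a, snd x + c * b) =
        gnorm x + c\<^sup>2 * gnorm (a, b) + c * (2 * (fst x * a + snd x * b))"
      by (simp add: gnorm_def power2_eq_square algebra_simps)
    ultimately show ?thesis
      using gnorm_ppow [of n] p that(2) by (simp add: cong_iff_dvd_diff)
  qed
  have shift: "2 ^ n dvd gnorm (fst x + c * a, snd x + c * b) \<and>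
      (2 ^ Suc n dvd gnorm (fst x + c * a, snd x + c * b) \<longleftrightarrow> \<not> 2 ^ Suc n dvd gnorm x)"
    if dvd: "?m dvd gnorm x" and "c\<^sup>2 = 1" for x c
  proof -
    \<comment> \<open>Adding \<open>?m\<close> to the norm \<open>?m * g\<close> flips the parity of
      the cofactor \<open>g\<close>.\<close>
    obtain g where g: "gnorm x = ?m * g" using dvd by blast
    note cong = norm_shift [OF that]
    have "2 ^ Suc n dvd gnorm x + ?m \<longleftrightarrow> ?m * 2 dvd ?m * (g + 1)"
      by (simp add: g algebra_simps)
    also have "\<dots> \<longleftrightarrow> odd g" by (subst dvd_mult_cancel_left) simp
    also have "\<dots> \<longleftrightarrow> \<not> ?m * 2 dvd ?m * g" by (subst dvd_mult_cancel_left) simp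
    finally have "2 ^ Suc n dvd gnorm x + ?m \<longleftrightarrow> \<not> 2 ^ Suc n dvd gnorm x"
      by (simp add: g mult.commute)
    moreover have "2 ^ n dvd gnorm x + ?m" using that by simp
    moreover have "[gnorm (fst x + c * a, snd x + c * b) = gnorm x + ?m] (mod (2 ^ n))"
      using cong by (rule cong_dvd_modulus) simp
    ultimately show ?thesis using cong_dvd_iff [OF cong] cong_dvd_iff by blast
  qed
  define I V where "I = ?I" and "V = ?V"
  have sI: "s x \<in> I \<and> (s x \<in> V \<longleftrightarrow> x \<notin> V)" and tI: "t x \<in> I \<and> (t x \<in> V \<longleftrightarrow> x \<notin> V)"
    if "x \<in> I" for x
    using that shift [of x 1] shift [of x "-1"] assms unfolding I_def V_def
    by (auto simp: s_def t_def red_in_carrier gnorm_red_dvd_iff simp del: power_Suc)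
  have st: "s (t x) = x" "t (s x) = x" if "x \<in> I" for x
    using that red_id [of x ?m] by (simp_all add: I_def s_def t_def red_def mod_simps prod_eq_iff)
  have VI: "V \<subseteq> I" by (auto simp: I_def V_def)
  have "bij_betw s V (I - V)"
    by (rule bij_betw_byWitness [where f' = t]) (use sI tI st VI in blast)+
  then have "card (I - V) = card V" by (simp add: bij_betw_same_card)
  moreover have "finite I" by (simp add: I_def finite_gauss_mod)
  then have "card (I - V) = card I - card V" "card V \<le> card I"
    using VI by (simp_all add: card_Diff_subset finite_subset card_mono)
  ultimately show ?thesis unfolding I_def V_def by simp
qed

theorem theorem3p3:
  fixes n :: nat
  assumes "n > 1"
  shows "int (saturation_number (zero_divisor_graph (gauss_mod (2 ^ n)))) =
    int (card (associate_class (gauss_mod (2 ^ n)) (gauss_d n n))) - 1"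
proof -
  have n: "n > 0" using assms by simp
  let ?m = "2 ^ n :: int"
  have m: "?m > 1" using n by simp
  let ?R = "gauss_mod ?m"
  let ?G = "zero_divisor_graph ?R"
  define I where "I = {x \<in> carrier ?R. ?m dvd gnorm x}"
  define V where "V = {x \<in> carrier ?R. ?m dvd gnorm x \<and> \<not> 2 ^ Suc n dvd gnorm x}"
  have card: "card I = 2 * card V" unfolding I_def V_def by (rule card_ideal_eq_twice [OF n])
  have V: "associate_class ?R (gauss_d n n) = V"
    unfolding V_def by (rule associate_class_gauss_d [OF n])
  have zero_iff: "x \<otimes>\<^bsub>?R\<^esub> y = \<zero>\<^bsub>?R\<^esub> \<longleftrightarrow> 2 ^ (2 * n) dvd gnorm x * gnorm y" for x y
    by (simp add: mult_gauss_mod [OF m] zero_gauss_mod red_eq_zero_iff gnorm_gmul)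
  have fin: "finite I" by (simp add: I_def finite_gauss_mod)
  have "V \<subseteq> I" by (auto simp: I_def V_def)
  have zero: "\<zero>\<^bsub>?R\<^esub> \<in> I" using m by (simp add: I_def zero_gauss_mod carrier_gauss_mod gnorm_def)
  have "card I \<noteq> 0" using zero fin by auto
  then have "card V \<noteq> 0" using card by simp
  \<comment> \<open>Any member of the associate class can be the vertex left unmatched.\<close>
  then obtain w where w: "w \<in> V" by (metis card.empty equals0I)
  define K where "K = I - {\<zero>\<^bsub>?R\<^esub>}"
  have wK: "w \<in> K" using w \<open>V \<subseteq> I\<close> by (auto simp: K_def V_def zero_gauss_mod gnorm_def)
  have cardK: "card K = 2 * (card V - 1) + 1"
    using card zero fin \<open>card V \<noteq> 0\<close> by (simp add: K_def)
  have prod: "x \<otimes>\<^bsub>?R\<^esub> y = \<zero>\<^bsub>?R\<^esub>" if "x \<in> K" "y \<in> K" for x y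
    using that unfolding zero_iff K_def I_def by (simp add: mult_2 power_add mult_dvd_mono)
  \<comment> \<open>Each \<open>x\<close> in \<open>K\<close> has square zero and so is its own
    witness.\<close>
  have "K \<subseteq> nonzero_zero_divisors ?R"
  proof
    fix x assume "x \<in> K"
    then show "x \<in> nonzero_zero_divisors ?R"
      using prod [of x x] unfolding nonzero_zero_divisors_def K_def I_def by blast
  qed
  then have clique: "{x, y} \<in> edges ?G" if "x \<in> K" "y \<in> K" "x \<noteq> y" for x y
    using that prod [of x y] unfolding zero_divisor_graph_def
      by (simp only: simple_graph.simps) blast
  \<comment> \<open>The exponents \<open>n\<close> and \<open>Suc n\<close> add up to one more than
    \<open>2 * n\<close>, so a product with \<open>2 * n\<close> factors 2 would violate one of the
    two bounds.\<close>
  have indep: "x \<otimes>\<^bsub>?R\<^esub> y \<noteq> \<zero>\<^bsub>?R\<^esub>"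
    if "\<not> ?m dvd gnorm x" "\<not> 2 ^ Suc n dvd gnorm y" for x y
    using prime_elem_power_dvd_cases [of "2 :: int" "2 * n" "gnorm x" "gnorm y" n "Suc n"] that
    unfolding zero_iff by (auto simp: mult_2 simp del: power_Suc)
  have meet: "e \<inter> (K - {w}) \<noteq> {}" if edge: "e \<in> edges ?G" for e
  proof
    assume disj: "e \<inter> (K - {w}) = {}"
    obtain x y where e: "e = {x, y}" "x \<in> nonzero_zero_divisors ?R"
      "y \<in> nonzero_zero_divisors ?R" "x \<noteq> y" "x \<otimes>\<^bsub>?R\<^esub> y = \<zero>\<^bsub>?R\<^esub>"
      using edge unfolding zero_divisor_graph_def
      by (simp only: simple_graph.simps) blast
    \<comment> \<open>Endpoints are nonzero, so one that lies in the ideal must be \<open>w\<close>.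
      As the endpoints differ, one lies outside the ideal; \<open>low\<close> bounds the other, and
      \<open>indep\<close> applies in one of the two orders.\<close>
    have outside: "z = w \<or> \<not> ?m dvd gnorm z" if "z \<in> e" for z
      using that e disj by (auto simp: nonzero_zero_divisors_def K_def I_def)
    have low: "\<not> 2 ^ Suc n dvd gnorm z" if "z \<in> e" for z
      using outside [OF that] w by (auto simp: V_def dest: dvd_mult_right)
    have "y \<otimes>\<^bsub>?R\<^esub> x = \<zero>\<^bsub>?R\<^esub>" using e(5) by (simp add: zero_iff mult.commute)
    then show False
      using indep [of x y] indep [of y x] outside [of x] outside [of y] low [of x] low [of y] e
      by auto
  qed
  have "saturation_number ?G = card V - 1"
  proof (rule saturation_number_odd_clique [OF _ _ cardK wK _ clique meet])
    show "finite (edges ?G)" by (rule finite_edges_zero_divisor_graph [OF finite_gauss_mod])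
    show "finite K" using fin by (simp add: K_def)
    show "finite e \<and> card e \<le> 2" if "e \<in> edges ?G" for e
      using that by (auto simp: zero_divisor_graph_def card_insert_if)
  qed
  then show ?thesis using \<open>card V \<noteq> 0\<close> V by simp
qed

end
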